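(* Let $(U,\mathscr{B})$, $\Gamma$, $\Gamma^*$, $S\subseteq\mathbb{R}^r$, $A,B:S\times U\to\mathbb{R}$, $I_\alpha(\Psi)$ and $C(\alpha,u)$ be as described in the context. Assume: (i) the integrals $\int_U A(\alpha,u)\,d\Psi(u)$ and $\int_U B(\alpha,u)\,d\Psi(u)$ exist for all $\Psi\in\Gamma$, $\alpha\in S$; (ii) $\Gamma^*\subset\Gamma$ (every degenerate probability measure belongs to $\Gamma$); (iii) $B$ is strictly of constant sign: either $B(\alpha,u)>0$ for all $(\alpha,u)\in S\times U$, or $B(\alpha,u)<0$ for all $(\alpha,u)\in S\times U$. Assume also that the test function $C(\alpha,u)=A(\alpha,u)/B(\alpha,u)$ attains its global extremum (maximum or minimum) on the whole set $S\times U$ at a point $(\alpha^*,u^* )$. Then the solution of the extremal problem $I_\alpha(\Psi)\to\operatorname{extr}$, $\Psi\in\Gamma$, $\alpha\in S$, exists and is attained on the pair $(\alpha^*,\Psi^*_{u^*})$, where $\Psi^*_{u^*}$ is the degenerate probability measure concentrated at the point $u^*$, and the following relations hold. If $(\alpha^*,u^* )$ is a point of global maximum of the function $C(\alpha,u)$, then $$\max_{(\alpha,\Psi)\in S\times\Gamma} I_\alpha(\Psi)=\max_{\alpha\in S}\max_{\Psi^*\in\Gamma^*} I_\alpha(\Psi^* )=\max_{(\alpha,u)\in S\times U}\frac{A(\alpha,u)}{B(\alpha,u)}=\frac{A(\alpha^*,u^* )}{B(\alpha^*,u^* )}.$$ If $(\alpha^*,u^* )$ is a point of global minimum of the function $C(\alpha,u)$,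 then $$\min_{(\alpha,\Psi)\in S\times\Gamma} I_\alpha(\Psi)=\min_{\alpha\in S}\min_{\Psi^*\in\Gamma^*} I_\alpha(\Psi^* )=\min_{(\alpha,u)\in S\times U}\frac{A(\alpha,u)}{B(\alpha,u)}=\frac{A(\alpha^*,u^* )}{B(\alpha^*,u^* )}.$$
   Context: $(U,\mathscr{B})$ is a measurable space: $U$ is an arbitrary set and $\mathscr{B}$ is a $\sigma$-algebra of subsets of $U$ containing all singletons. $\Gamma$ is a set of probability measures on $\mathscr{B}$. A probability measure $\Psi^*$ on $\mathscr{B}$ is called degenerate if there is a point $u^*\in U$ (the concentration point) such that $\Psi^*(\{u^*\})=1$ and $\Psi^*(B^* )=0$ for every $B^*\in\mathscr{B}$ not containing $u^*$; it is then denoted $\Psi^*_{u^*}$. $\Gamma^*$ is the set of all degenerate probability measures on $(U,\mathscr{B})$. $S\subseteq\mathbb{R}^r$ is a set of values of a vector parameter $\alpha=(\alpha_1,\dots,\alpha_r)$. $A,B:S\times U\to\mathbb{R}$ are measurable functions. For $\alpha\in S$, $\Psi\in\Gamma$ put $$I_\alpha(\Psi)=\frac{\int_U A(\alpha,u)\,d\Psi(u)}{\int_U B(\alpha,u)\,d\Psi(u)},$$ where the integrals are Lebesgue integrals with respect to $\Psi$ and, as functionals of $\Psi\in\Gamma$, take values in $\mathbb{R}$ (so "exist" means exist with finite real values). The test function is $C(\alpha,u)=A(\alpha,u)/B(\alpha,u)$, $(\alpha,u)\in S\times U$.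
   Formalization: In the iterated extremum over α and Γ*, the inner max (min) is read as a finite supremum (infimum), since for α other than α* it need not be attained; it is attained with the stated value for at least one α. *)

theory Defs
  imports "HOL-Probability.Probability"
begin

text \<open>
  A measurable space is given by a value \<open>M\<close> of type \<open>'u measure\<close> of which only
  \<open>space M\<close> and \<open>sets M\<close> are used. A probability measure on it is a \<open>\<Psi>\<close> with
  \<open>prob_space \<Psi>\<close> and \<open>sets \<Psi> = sets M\<close> (hence also \<open>space \<Psi> = space M\<close>).
\<close>

definition prob_measures_on :: "'u measure \<Rightarrow> 'u measure set" where
  "prob_measures_on M = {\<Psi>. prob_space \<Psi> \<and> sets \<Psi> = sets M}"

definition degenerate_at :: "'u measure \<Rightarrow> 'u \<Rightarrow> 'u measure \<Rightarrow> bool" where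
  "degenerate_at M u \<Psi> \<longleftrightarrow> \<Psi> \<in> prob_measures_on M \<and> u \<in> space M \<and>
     measure \<Psi> {u} = 1 \<and> (\<forall>E\<in>sets M. u \<notin> E \<longrightarrow> measure \<Psi> E = 0)"

definition degenerate_measures :: "'u measure \<Rightarrow> 'u measure set" where
  "degenerate_measures M = {\<Psi>. \<exists>u. degenerate_at M u \<Psi>}"

text \<open>
  The degenerate measure concentrated at \<open>u\<close> is unique, and it is the library's
  Dirac measure \<open>return M u\<close>.
\<close>

lemma degenerate_at_iff_return:
  assumes "u \<in> space M" "{u} \<in> sets M"
  shows "degenerate_at M u \<Psi> \<longleftrightarrow> \<Psi> = return M u"
proof
  assume d: "degenerate_at M u \<Psi>"
  then interpret prob_space \<Psi>
    by (simp add: degenerate_at_def prob_measures_on_def)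
  have sets_eq: "sets \<Psi> = sets M"
    using d by (simp add: degenerate_at_def prob_measures_on_def)
  have sp: "space \<Psi> = space M" using sets_eq by (rule sets_eq_imp_space_eq)
  show "\<Psi> = return M u"
  proof (rule measure_eqI)
    show "sets \<Psi> = sets (return M u)" using sets_eq by simp
  next
    fix E assume E: "E \<in> sets \<Psi>"
    have "measure \<Psi> E = indicator E u"
    proof (cases "u \<in> E")
      case True
      have "measure \<Psi> {u} \<le> measure \<Psi> E"
        using True E by (intro finite_measure_mono) auto
      then have "measure \<Psi> E = 1"
        using d by (intro antisym prob_le_1) (simp add: degenerate_at_def)
      then show ?thesis using True by simp
    next
      case False
      then show ?thesis using d E sets_eq by (simp add: degenerate_at_def)
    qed
    then show "emeasure \<Psi> E = emeasure (return M u) E"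
      using E sets_eq by (simp add: emeasure_eq_measure indicator_def)
  qed
next
  assume "\<Psi> = return M u"
  then show "degenerate_at M u \<Psi>"
    using assms
    by (auto simp: degenerate_at_def prob_measures_on_def prob_space_return measure_return)
qed

definition ratio_functional ::
    "('p \<times> 'u \<Rightarrow> real) \<Rightarrow> ('p \<times> 'u \<Rightarrow> real) \<Rightarrow> 'p \<Rightarrow> 'u measure \<Rightarrow> real" where
  "ratio_functional A B \<alpha> \<Psi> = (\<integral>u. A (\<alpha>, u) \<partial>\<Psi>) / (\<integral>u. B (\<alpha>, u) \<partial>\<Psi>)"

definition test_function ::
    "('p \<times> 'u \<Rightarrow> real) \<Rightarrow> ('p \<times> 'u \<Rightarrow> real) \<Rightarrow> 'p \<times> 'u \<Rightarrow> real" where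
  "test_function A B p = A p / B p"

text \<open>
  \<open>has_max f X m\<close> says that the maximum of \<open>f\<close> over \<open>X\<close> exists (is attained) and
  equals \<open>m\<close>; the library's \<open>Max\<close> is meaningful for finite sets only.
\<close>

definition has_max :: "('a \<Rightarrow> real) \<Rightarrow> 'a set \<Rightarrow> real \<Rightarrow> bool" where
  "has_max f X m \<longleftrightarrow> (\<exists>x\<in>X. f x = m) \<and> (\<forall>x\<in>X. f x \<le> m)"

definition has_min :: "('a \<Rightarrow> real) \<Rightarrow> 'a set \<Rightarrow> real \<Rightarrow> bool" where
  "has_min f X m \<longleftrightarrow> (\<exists>x\<in>X. f x = m) \<and> (\<forall>x\<in>X. m \<le> f x)"

text \<open>
  The iterated maximum of \<open>f x y\<close> over \<open>x \<in> X\<close> and then \<open>y \<in> Y\<close>. For an \<open>x\<close> other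
  than the optimal one the inner maximum over \<open>Y\<close> need not be attained even if the
  joint maximum is, so for such \<open>x\<close> the inner maximum is read as the (finite)
  supremum, with which it agrees whenever it exists. The last conjunct requires
  the inner maximum to be attained, with value \<open>m\<close>, at some \<open>x\<close>; by the others,
  this \<open>x\<close> is then optimal for the outer maximum.
\<close>

definition has_iterated_max :: "('a \<Rightarrow> 'b \<Rightarrow> real) \<Rightarrow> 'a set \<Rightarrow> 'b set \<Rightarrow> real \<Rightarrow> bool" where
  "has_iterated_max f X Y m \<longleftrightarrow>
     (\<forall>x\<in>X. bdd_above (f x ` Y)) \<and> has_max (\<lambda>x. SUP y\<in>Y. f x y) X m \<and>
     (\<exists>x\<in>X. has_max (f x) Y m)"

definition has_iterated_min :: "('a \<Rightarrow> 'b \<Rightarrow> real) \<Rightarrow> 'a set \<Rightarrow> 'b set \<Rightarrow> real \<Rightarrow> bool" where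
  "has_iterated_min f X Y m \<longleftrightarrow>
     (\<forall>x\<in>X. bdd_below (f x ` Y)) \<and> has_min (\<lambda>x. INF y\<in>Y. f x y) X m \<and>
     (\<exists>x\<in>X. has_min (f x) Y m)"

end

theory Submission
  imports Defs
begin

text \<open>
  Since \<open>B\<close> has constant sign, a pointwise bound \<open>A / B \<le> m\<close> says that \<open>A - m B\<close> is
  nowhere of the same sign as \<open>B\<close>. Integration against a probability measure preserves
  this, and it keeps the sign of \<open>B\<close> strict, so the quotient of the integrals obeys the same
  bound (\<open>integral_ratio_le\<close>). Equivalently, \<open>I\<^sub>\<alpha>(\<Psi>)\<close> is the mean of
  the test function \<open>C(\<alpha>, \<cdot>)\<close> under \<open>\<Psi>\<close> reweighted by \<open>B(\<alpha>, \<cdot>)\<close>, and a mean never exceeds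
  the maximum. At a Dirac measure the quotient of integrals is the value of \<open>C\<close> itself
  (\<open>ratio_functional_return\<close>), so an extremum of \<open>C\<close> is reached by \<open>I\<close> at the Dirac measure
  concentrated there, already inside \<open>\<Gamma>\<^sup>*\<close>. So the maxima of \<open>I\<close> over
  \<open>\<Gamma>\<close> and over \<open>\<Gamma>\<^sup>*\<close> have the maximum of \<open>C\<close> both as a value and as an upper bound.

  Minimizing with numerator \<open>A\<close> is maximizing with numerator \<open>-A\<close>, because all the quotients are
  linear in \<open>A\<close>.
\<close>

text \<open>
  The integral of \<open>b\<close> is nonzero with the sign of \<open>b\<close>, because a nonnegative function with zero
  integral vanishes almost everywhere and the space has positive measure. Hence the quotient
  can be cleared. A negative \<open>b\<close> is reduced to a positive one by changing the sign of both
  numerator and denominator.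
\<close>

lemma (in prob_space) integral_ratio_le:
  fixes a b :: "'a \<Rightarrow> real"
  assumes a: "integrable M a" and b: "integrable M b"
    and sign: "(\<forall>x\<in>space M. b x > 0) \<or> (\<forall>x\<in>space M. b x < 0)"
    and le: "\<And>x. x \<in> space M \<Longrightarrow> a x / b x \<le> m"
  shows "(\<integral>x. a x \<partial>M) / (\<integral>x. b x \<partial>M) \<le> m"
proof -
  have pos_case: "(\<integral>x. f x \<partial>M) / (\<integral>x. g x \<partial>M) \<le> m"
    if f: "integrable M f" and g: "integrable M g"
      and pos: "\<And>x. x \<in> space M \<Longrightarrow> g x > 0"
      and le: "\<And>x. x \<in> space M \<Longrightarrow> f x / g x \<le> m" for f g :: "'a \<Rightarrow> real"
  proof -
    have "expectation g > 0"
      using pos g by (intro expectation_greater AE_I2) auto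
    moreover have "expectation f \<le> expectation (\<lambda>x. m * g x)"
      using f g pos le by (intro integral_mono) (auto simp: pos_divide_le_eq)
    ultimately show ?thesis
      by (simp add: pos_divide_le_eq)
  qed
  show ?thesis
    using sign
  proof
    assume "\<forall>x\<in>space M. b x > 0"
    then show ?thesis using a b le by (intro pos_case) auto
  next
    assume "\<forall>x\<in>space M. b x < 0"
    then show ?thesis using pos_case[of "\<lambda>x. - a x" "\<lambda>x. - b x"] a b le by simp
  qed
qed

lemma ratio_functional_return:
  assumes "u \<in> space M"
    and "integrable (return M u) (\<lambda>v. A (\<alpha>, v))" "integrable (return M u) (\<lambda>v. B (\<alpha>, v))"
  shows "ratio_functional A B \<alpha> (return M u) = A (\<alpha>, u) / B (\<alpha>, u)"
  using assms borel_measurable_integrable[OF assms(2)] borel_measurable_integrable[OF assms(3)]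
  by (simp add: ratio_functional_def integral_return)

lemma return_in_degenerate_measures:
  assumes "u \<in> space M" "{u} \<in> sets M"
  shows "return M u \<in> degenerate_measures M"
  using degenerate_at_iff_return[OF assms] by (auto simp: degenerate_measures_def)

text \<open>
  A global bound that is attained settles the iterated maximum too: the bound makes every
  inner supremum finite and at most \<open>m\<close>, and the attaining point makes one of them equal to \<open>m\<close>.
\<close>

lemma has_iterated_maxI:
  assumes bound: "\<And>x y. x \<in> X \<Longrightarrow> y \<in> Y \<Longrightarrow> f x y \<le> m"
    and at: "x0 \<in> X" "y0 \<in> Y" "f x0 y0 = m"
  shows "has_iterated_max f X Y m"
proof -
  have bdd: "bdd_above (f x ` Y)" if "x \<in> X" for x
    using bound[OF that] by (auto intro!: bdd_aboveI2)
  have le: "(SUP y\<in>Y. f x y) \<le> m" if "x \<in> X" for x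
    using bound[OF that] at(2) by (intro cSUP_least) auto
  have "(SUP y\<in>Y. f x0 y) = m"
    using le[OF at(1)] cSUP_upper[OF at(2) bdd[OF at(1)]] at(3) by simp
  then have "has_max (\<lambda>x. SUP y\<in>Y. f x y) X m"
    unfolding has_max_def using at(1) le by (intro conjI ballI bexI[of _ x0])
  moreover have "has_max (f x0) Y m"
    unfolding has_max_def using at bound[OF at(1)] by (intro conjI ballI bexI[of _ y0])
  ultimately show ?thesis
    unfolding has_iterated_max_def using bdd at(1) by (intro conjI ballI bexI[of _ x0])
qed

text \<open>The reflection \<open>f \<mapsto> -f\<close> carries each notion of minimum to that of maximum.\<close>

lemma is_arg_min_iff_is_arg_max_uminus:
  fixes f :: "'a \<Rightarrow> real"
  shows "is_arg_min f P x \<longleftrightarrow> is_arg_max (\<lambda>x. - f x) P x"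
  by (simp add: is_arg_min_def is_arg_max_def)

lemma has_min_iff_has_max_uminus: "has_min f X m \<longleftrightarrow> has_max (\<lambda>x. - f x) X (- m)"
  by (simp add: has_min_def has_max_def)

lemma has_iterated_min_iff_has_iterated_max_uminus:
  "has_iterated_min f X Y m \<longleftrightarrow> has_iterated_max (\<lambda>x y. - f x y) X Y (- m)"
proof -
  have "bdd_below (f x ` Y) \<longleftrightarrow> bdd_above ((\<lambda>y. - f x y) ` Y)" for x
    using bdd_below_uminus[of "(\<lambda>y. - f x y) ` Y"] by (simp add: image_image)
  moreover have "(INF y\<in>Y. f x y) = - (SUP y\<in>Y. - f x y)" for x
    by (simp add: Inf_real_def image_image)
  ultimately show ?thesis
    by (simp add: has_iterated_min_def has_iterated_max_def has_min_iff_has_max_uminus)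
qed

lemma ratio_functional_uminus:
  "ratio_functional (\<lambda>p. - A p) B \<alpha> \<Psi> = - ratio_functional A B \<alpha> \<Psi>"
  by (simp add: ratio_functional_def)

text \<open>
  The maximum half, for a parameter set without any structure. The bound comes from
  \<open>integral_ratio_le\<close> and attainment from the Dirac measure at the maximum point.
\<close>

lemma ratio_functional_maximum:
  assumes singletons: "\<And>u. u \<in> space M \<Longrightarrow> {u} \<in> sets M"
    and Gamma: "\<Gamma> \<subseteq> prob_measures_on M"
    and A_int: "\<And>\<alpha> \<Psi>. \<alpha> \<in> S \<Longrightarrow> \<Psi> \<in> \<Gamma> \<Longrightarrow> integrable \<Psi> (\<lambda>u. A (\<alpha>, u))"
    and B_int: "\<And>\<alpha> \<Psi>. \<alpha> \<in> S \<Longrightarrow> \<Psi> \<in> \<Gamma> \<Longrightarrow> integrable \<Psi> (\<lambda>u. B (\<alpha>, u))"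
    and degenerate: "degenerate_measures M \<subseteq> \<Gamma>"
    and B_sign: "(\<forall>p \<in> S \<times> space M. B p > 0) \<or> (\<forall>p \<in> S \<times> space M. B p < 0)"
    and maximum: "is_arg_max (test_function A B) (\<lambda>p. p \<in> S \<times> space M) (\<alpha>s, us)"
  shows "is_arg_max (\<lambda>(\<alpha>, \<Psi>). ratio_functional A B \<alpha> \<Psi>) (\<lambda>q. q \<in> S \<times> \<Gamma>) (\<alpha>s, return M us)"
    and "has_max (\<lambda>(\<alpha>, \<Psi>). ratio_functional A B \<alpha> \<Psi>) (S \<times> \<Gamma>) (A (\<alpha>s, us) / B (\<alpha>s, us))"
    and "has_iterated_max (ratio_functional A B) S (degenerate_measures M)
           (A (\<alpha>s, us) / B (\<alpha>s, us))"
    and "has_max (\<lambda>(\<alpha>, u). A (\<alpha>, u) / B (\<alpha>, u)) (S \<times> space M) (A (\<alpha>s, us) / B (\<alpha>s, us))"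
proof -
  define m where "m = A (\<alpha>s, us) / B (\<alpha>s, us)"
  have \<alpha>s: "\<alpha>s \<in> S" and us: "us \<in> space M"
    using maximum by (auto simp: is_arg_max_def)
  have pointwise: "A (\<alpha>, u) / B (\<alpha>, u) \<le> m" if "\<alpha> \<in> S" "u \<in> space M" for \<alpha> u
    using maximum that by (auto simp: is_arg_max_linorder test_function_def m_def)
  have bound: "ratio_functional A B \<alpha> \<Psi> \<le> m" if \<alpha>: "\<alpha> \<in> S" and \<Psi>: "\<Psi> \<in> \<Gamma>" for \<alpha> \<Psi>
  proof -
    interpret prob_space \<Psi>
      using Gamma \<Psi> by (auto simp: prob_measures_on_def)
    have space_eq: "space \<Psi> = space M"
      using Gamma \<Psi> by (intro sets_eq_imp_space_eq) (auto simp: prob_measures_on_def)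
    show ?thesis
      unfolding ratio_functional_def
      using A_int[OF \<alpha> \<Psi>] B_int[OF \<alpha> \<Psi>] B_sign \<alpha> pointwise[OF \<alpha>]
      by (intro integral_ratio_le) (auto simp: space_eq)
  qed
  have dirac: "return M us \<in> degenerate_measures M"
    using us singletons by (intro return_in_degenerate_measures)
  then have dirac_Gamma: "return M us \<in> \<Gamma>"
    using degenerate by blast
  have attained: "ratio_functional A B \<alpha>s (return M us) = m"
    unfolding m_def
    using us A_int[OF \<alpha>s dirac_Gamma] B_int[OF \<alpha>s dirac_Gamma]
    by (rule ratio_functional_return)
  show "is_arg_max (\<lambda>(\<alpha>, \<Psi>). ratio_functional A B \<alpha> \<Psi>) (\<lambda>q. q \<in> S \<times> \<Gamma>) (\<alpha>s, return M us)"
    using bound attained \<alpha>s dirac_Gamma by (auto simp: is_arg_max_linorder)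
  show "has_max (\<lambda>(\<alpha>, \<Psi>). ratio_functional A B \<alpha> \<Psi>) (S \<times> \<Gamma>) (A (\<alpha>s, us) / B (\<alpha>s, us))"
    using bound attained \<alpha>s dirac_Gamma unfolding has_max_def m_def[symmetric] by force
  show "has_iterated_max (ratio_functional A B) S (degenerate_measures M)
          (A (\<alpha>s, us) / B (\<alpha>s, us))"
    unfolding m_def[symmetric] using bound degenerate \<alpha>s dirac attained
    by (intro has_iterated_maxI) auto
  show "has_max (\<lambda>(\<alpha>, u). A (\<alpha>, u) / B (\<alpha>, u)) (S \<times> space M) (A (\<alpha>s, us) / B (\<alpha>s, us))"
    using pointwise \<alpha>s us unfolding has_max_def m_def by force
qed

theorem theorem1:
  fixes M :: "'u measure"
    and \<Gamma> :: "'u measure set"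
    and S :: "(real ^ 'r) set"
    and A B :: "(real ^ 'r) \<times> 'u \<Rightarrow> real"
    and \<alpha>s :: "real ^ 'r" and us :: 'u
  assumes singletons: "\<And>u. u \<in> space M \<Longrightarrow> {u} \<in> sets M"
    and Gamma: "\<Gamma> \<subseteq> prob_measures_on M"
    and A_meas: "A \<in> borel_measurable (restrict_space borel S \<Otimes>\<^sub>M M)"
    and B_meas: "B \<in> borel_measurable (restrict_space borel S \<Otimes>\<^sub>M M)"
    and A_int: "\<And>\<alpha> \<Psi>. \<alpha> \<in> S \<Longrightarrow> \<Psi> \<in> \<Gamma> \<Longrightarrow> integrable \<Psi> (\<lambda>u. A (\<alpha>, u))"
    and B_int: "\<And>\<alpha> \<Psi>. \<alpha> \<in> S \<Longrightarrow> \<Psi> \<in> \<Gamma> \<Longrightarrow> integrable \<Psi> (\<lambda>u. B (\<alpha>, u))"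
    and degenerate: "degenerate_measures M \<subseteq> \<Gamma>"
    and B_sign: "(\<forall>p \<in> S \<times> space M. B p > 0) \<or> (\<forall>p \<in> S \<times> space M. B p < 0)"
    and extremum:
      "is_arg_max (test_function A B) (\<lambda>p. p \<in> S \<times> space M) (\<alpha>s, us) \<or>
       is_arg_min (test_function A B) (\<lambda>p. p \<in> S \<times> space M) (\<alpha>s, us)"
  shows
    "(is_arg_max (test_function A B) (\<lambda>p. p \<in> S \<times> space M) (\<alpha>s, us) \<longrightarrow>
        is_arg_max (\<lambda>(\<alpha>, \<Psi>). ratio_functional A B \<alpha> \<Psi>) (\<lambda>q. q \<in> S \<times> \<Gamma>) (\<alpha>s, return M us) \<and>
        has_max (\<lambda>(\<alpha>, \<Psi>). ratio_functional A B \<alpha> \<Psi>) (S \<times> \<Gamma>) (A (\<alpha>s, us) / B (\<alpha>s, us)) \<and>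
        has_iterated_max (ratio_functional A B) S (degenerate_measures M) (A (\<alpha>s, us) / B (\<alpha>s, us)) \<and>
        has_max (\<lambda>(\<alpha>, u). A (\<alpha>, u) / B (\<alpha>, u)) (S \<times> space M) (A (\<alpha>s, us) / B (\<alpha>s, us))) \<and>
     (is_arg_min (test_function A B) (\<lambda>p. p \<in> S \<times> space M) (\<alpha>s, us) \<longrightarrow>
        is_arg_min (\<lambda>(\<alpha>, \<Psi>). ratio_functional A B \<alpha> \<Psi>) (\<lambda>q. q \<in> S \<times> \<Gamma>) (\<alpha>s, return M us) \<and>
        has_min (\<lambda>(\<alpha>, \<Psi>). ratio_functional A B \<alpha> \<Psi>) (S \<times> \<Gamma>) (A (\<alpha>s, us) / B (\<alpha>s, us)) \<and>
        has_iterated_min (ratio_functional A B) S (degenerate_measures M) (A (\<alpha>s, us) / B (\<alpha>s, us)) \<and>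
        has_min (\<lambda>(\<alpha>, u). A (\<alpha>, u) / B (\<alpha>, u)) (S \<times> space M) (A (\<alpha>s, us) / B (\<alpha>s, us)))"
proof (intro conjI impI)
  assume max: "is_arg_max (test_function A B) (\<lambda>p. p \<in> S \<times> space M) (\<alpha>s, us)"
  note maximum = ratio_functional_maximum[OF singletons Gamma A_int B_int degenerate B_sign max]
  show "is_arg_max (\<lambda>(\<alpha>, \<Psi>). ratio_functional A B \<alpha> \<Psi>) (\<lambda>q. q \<in> S \<times> \<Gamma>) (\<alpha>s, return M us)"
    by (rule maximum(1))
  show "has_max (\<lambda>(\<alpha>, \<Psi>). ratio_functional A B \<alpha> \<Psi>) (S \<times> \<Gamma>) (A (\<alpha>s, us) / B (\<alpha>s, us))"
    by (rule maximum(2))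
  show "has_iterated_max (ratio_functional A B) S (degenerate_measures M) (A (\<alpha>s, us) / B (\<alpha>s, us))"
    by (rule maximum(3))
  show "has_max (\<lambda>(\<alpha>, u). A (\<alpha>, u) / B (\<alpha>, u)) (S \<times> space M) (A (\<alpha>s, us) / B (\<alpha>s, us))"
    by (rule maximum(4))
next
  assume min: "is_arg_min (test_function A B) (\<lambda>p. p \<in> S \<times> space M) (\<alpha>s, us)"
  have max: "is_arg_max (test_function (\<lambda>p. - A p) B) (\<lambda>p. p \<in> S \<times> space M) (\<alpha>s, us)"
    using min by (simp add: is_arg_min_iff_is_arg_max_uminus test_function_def[abs_def])
  have neg_A_int: "integrable \<Psi> (\<lambda>u. - A (\<alpha>, u))" if "\<alpha> \<in> S" "\<Psi> \<in> \<Gamma>" for \<alpha> \<Psi>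
    using A_int[OF that] by simp
  note maximum =
    ratio_functional_maximum[OF singletons Gamma neg_A_int B_int degenerate B_sign max]
  show "is_arg_min (\<lambda>(\<alpha>, \<Psi>). ratio_functional A B \<alpha> \<Psi>) (\<lambda>q. q \<in> S \<times> \<Gamma>) (\<alpha>s, return M us)"
    using maximum(1)
    by (simp add: is_arg_min_iff_is_arg_max_uminus ratio_functional_uminus case_prod_unfold)
  show "has_min (\<lambda>(\<alpha>, \<Psi>). ratio_functional A B \<alpha> \<Psi>) (S \<times> \<Gamma>) (A (\<alpha>s, us) / B (\<alpha>s, us))"
    using maximum(2)
    by (simp add: has_min_iff_has_max_uminus ratio_functional_uminus case_prod_unfold)
  show "has_iterated_min (ratio_functional A B) S (degenerate_measures M) (A (\<alpha>s, us) / B (\<alpha>s, us))"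
    using maximum(3)
    by (simp add: has_iterated_min_iff_has_iterated_max_uminus ratio_functional_uminus[abs_def])
  show "has_min (\<lambda>(\<alpha>, u). A (\<alpha>, u) / B (\<alpha>, u)) (S \<times> space M) (A (\<alpha>s, us) / B (\<alpha>s, us))"
    using maximum(4)
    by (simp add: has_min_iff_has_max_uminus case_prod_unfold)
qed

end
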